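(* Let $1\le p<\infty$ and $f\in H^p(\mathcal{U})$. If $\mathcal{L}^{\alpha} f\equiv 0$ on $\mathcal{U}$ for some multi-index $\alpha\in\mathbb{N}_0^n$, then $f\equiv 0$.
   Context: Let $n$ be a positive integer. $\mathbb{N}_0$ denotes the nonnegative integers. Write $z=(z',z_n)\in\mathbb{C}^n$ with $z'=(z_1,\dots,z_{n-1})\in\mathbb{C}^{n-1}$, $z_n\in\mathbb{C}$. The Siegel upper half-space is $\mathcal{U}=\{z\in\mathbb{C}^n:\mathrm{Im}\,z_n>|z'|^2\}$, with boundary $b\mathcal{U}=\{z:\mathrm{Im}\,z_n=|z'|^2\}$. Put $\mathbf{i}=(0',i)\in\mathcal{U}$. The measure $d\beta$ on $b\mathcal{U}$ is defined by $\int_{b\mathcal{U}}f\,d\beta=\int_{\mathbb{C}^{n-1}\times\mathbb{R}}f(z',t+i|z'|^2)\,dz'\,dt$ (Lebesgue measure on the right). The Hardy space $H^p(\mathcal{U})$ is the space of holomorphic functions $f$ on $\mathcal{U}$ with $\|f\|_{H^p(\mathcal{U})}=\sup_{\epsilon>0}\left(\int_{b\mathcal{U}}|f(u+\epsilon\mathbf{i})|^p\,d\beta(u)\right)^{1/p}<\infty$. Differential operators: $\mathcal{L}_j=\frac{\partial}{\partial z_j}+2i\bar z_j\frac{\partial}{\partial z_n}$ for $1\le j\le n-1$, $\mathcal{L}_n=\frac{\partial}{\partial z_n}$, and $\mathcal{L}^{\alpha}=(\mathcal{L}_1)^{\alpha_1}\cdots(\mathcal{L}_n)^{\alpha_n}$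 for $\alpha\in\mathbb{N}_0^n$ (here $\partial/\partial z_j$ are the Wirtinger derivatives). *)

theory Defs
  imports "HOL-Analysis.Analysis"
begin

text \<open>Points of \<open>\<complex>\<^sup>n\<close> are vectors \<open>complex ^ 'n\<close>, where \<open>'n\<close> is an arbitrary (nonempty) finite
  linearly ordered type. The greatest index plays the role of \<open>n\<close>, and \<open>- {last_ix}\<close> indexes the
  coordinates of \<open>z'\<close>; this index set is empty when \<open>n = 1\<close>.\<close>

definition last_ix :: "'n::{finite,linorder}"
  where "last_ix = Max UNIV"

definition siegel :: "(complex ^ 'n::{finite,linorder}) set"
  where "siegel = {z. Im (z $ last_ix) > (\<Sum>j\<in>- {last_ix}. (cmod (z $ j))\<^sup>2)}"

definition siegel_boundary :: "(complex ^ 'n::{finite,linorder}) set"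
  where "siegel_boundary = {z. Im (z $ last_ix) = (\<Sum>j\<in>- {last_ix}. (cmod (z $ j))\<^sup>2)}"

definition base_pt :: "complex ^ 'n::{finite,linorder}"
  where "base_pt = axis last_ix \<i>"

definition boundary_param :: "('n \<Rightarrow> complex) \<times> real \<Rightarrow> complex ^ 'n::{finite,linorder}"
  where "boundary_param = (\<lambda>(w, t). \<chi> j.
    if j = last_ix then of_real t + \<i> * of_real (\<Sum>k\<in>- {last_ix}. (cmod (w k))\<^sup>2) else w j)"

text \<open>A measure on the boundary itself: \<open>f (u + \<epsilon> \<^bold>i)\<close> need only be
  measurable for \<open>u\<close> there, since \<open>f\<close> is unspecified outside the half-space.\<close>

definition boundary_measure :: "(complex ^ 'n::{finite,linorder}) measure"
  where "boundary_measure =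
    distr ((\<Pi>\<^sub>M j\<in>- {last_ix :: 'n}. (lborel :: complex measure)) \<Otimes>\<^sub>M (lborel :: real measure))
      (restrict_space borel siegel_boundary) boundary_param"

lemma boundary_param_measurable:
  "boundary_param \<in> measurable
     ((\<Pi>\<^sub>M j\<in>- {last_ix :: 'n::{finite,linorder}}. (lborel :: complex measure)) \<Otimes>\<^sub>M (lborel :: real measure))
     (restrict_space borel siegel_boundary)" (is "_ \<in> measurable ?M _")
proof (rule measurable_restrict_space2)
  show "boundary_param \<in> space ?M \<rightarrow> siegel_boundary"
    by (auto simp: boundary_param_def siegel_boundary_def)
  have comp: "(\<lambda>x. fst x k) \<in> borel_measurable ?M" if "k \<noteq> last_ix" for k :: 'n
    by (rule measurable_compose[OF measurable_fst measurable_component_singleton[where M="\<lambda>_. lborel :: complex measure", simplified]]) (use that in auto)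
  have "(\<lambda>x. boundary_param x $ j) \<in> borel_measurable ?M" for j :: 'n
  proof (cases "j = last_ix")
    case True
    have "(\<lambda>x. \<Sum>k\<in>- {last_ix :: 'n}. (cmod (fst x k))\<^sup>2) \<in> borel_measurable ?M"
      by (intro borel_measurable_sum borel_measurable_power measurable_compose[OF comp]) auto
    moreover have "snd \<in> borel_measurable ?M"
      by measurable
    ultimately show ?thesis
      using True by (simp add: boundary_param_def case_prod_beta)
  next
    case False
    then show ?thesis
      using comp[OF False] by (simp add: boundary_param_def case_prod_beta)
  qed
  then show "boundary_param \<in> borel_measurable ?M"
    by (subst borel_measurable_euclidean_space) (auto simp: Basis_vec_def inner_axis)
qed

lemma nn_integral_boundary_measure:
  fixes f :: "complex ^ 'n::{finite,linorder} \<Rightarrow> ennreal"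
  assumes "f \<in> borel_measurable (restrict_space borel siegel_boundary)"
  shows "(\<integral>\<^sup>+ u. f u \<partial>boundary_measure) =
    (\<integral>\<^sup>+ x. f (boundary_param x)
       \<partial>((\<Pi>\<^sub>M j\<in>- {last_ix :: 'n}. (lborel :: complex measure)) \<Otimes>\<^sub>M (lborel :: real measure)))"
  unfolding boundary_measure_def by (rule nn_integral_distr[OF boundary_param_measurable]) (use assms in simp)

text \<open>Complex Frechet differentiability at every point (meant for open \<open>S\<close>).\<close>

definition holomorphic_vec_on :: "(complex ^ 'n \<Rightarrow> complex) \<Rightarrow> (complex ^ 'n) set \<Rightarrow> bool"
  where "holomorphic_vec_on f S \<longleftrightarrow>
    (\<forall>z\<in>S. \<exists>D. (f has_derivative D) (at z) \<and> Vector_Spaces.linear (*s) (*) D)"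

definition ennreal_powr :: "ennreal \<Rightarrow> real \<Rightarrow> ennreal"
  where "ennreal_powr x a = (if x = \<infinity> then \<infinity> else ennreal (enn2real x powr a))"

definition hardy_norm :: "real \<Rightarrow> (complex ^ 'n::{finite,linorder} \<Rightarrow> complex) \<Rightarrow> ennreal"
  where "hardy_norm p f = (SUP \<epsilon>\<in>{0<..}. ennreal_powr
    (\<integral>\<^sup>+ u. ennreal (cmod (f (u + \<epsilon> *\<^sub>R base_pt)) powr p) \<partial>boundary_measure) (1 / p))"

definition hardy_space :: "real \<Rightarrow> (complex ^ 'n::{finite,linorder} \<Rightarrow> complex) set"
  where "hardy_space p = {f. holomorphic_vec_on f siegel \<and> hardy_norm p f < \<infinity>}"

definition wirtinger :: "'n::finite \<Rightarrow> (complex ^ 'n \<Rightarrow> complex) \<Rightarrow> complex ^ 'n \<Rightarrow> complex"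
  where "wirtinger j f z =
    (vector_derivative (\<lambda>s::real. f (z + s *\<^sub>R axis j 1)) (at 0)
      - \<i> * vector_derivative (\<lambda>s::real. f (z + s *\<^sub>R axis j \<i>)) (at 0)) / 2"

definition L_op :: "'n::{finite,linorder} \<Rightarrow> (complex ^ 'n::{finite,linorder} \<Rightarrow> complex) \<Rightarrow> complex ^ 'n::{finite,linorder} \<Rightarrow> complex"
  where "L_op j f z =
    (if j = last_ix then wirtinger last_ix f z
     else wirtinger j f z + 2 * \<i> * cnj (z $ j) * wirtinger last_ix f z)"

text \<open>The operator for the least index is outermost, that for \<open>last_ix\<close> is applied first.\<close>

definition L_pow :: "nat ^ 'n::{finite,linorder} \<Rightarrow> (complex ^ 'n::{finite,linorder} \<Rightarrow> complex) \<Rightarrow> complex ^ 'n::{finite,linorder} \<Rightarrow> complex"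
  where "L_pow \<alpha> = foldr (\<lambda>j. L_op j ^^ (\<alpha> $ j)) (sorted_list_of_set UNIV)"

end

theory Submission
  imports Defs "HOL-Complex_Analysis.Cauchy_Integral_Formula"
begin

text \<open>
Write \<open>\<partial>\<^sub>j\<close> and \<open>\<partial>\<^sub>j\<^sup>-\<close> for the Wirtinger derivatives with respect to \<open>z\<^sub>j\<close> and its conjugate.
The proof turns the equation \<open>\<L>\<^sup>\<alpha> f = 0\<close> into the much simpler \<open>\<partial>\<^sub>n\<^sup>N f = 0\<close>, where
\<open>N\<close> is the sum of the entries of \<open>\<alpha>\<close>, and then plays this off against integrability.

The operators \<open>\<L>\<^sub>k\<close> contain conjugate variables only as coefficients, so
\<open>\<partial>\<^sub>j\<^sup>-\<close> commutes with \<open>\<L>\<^sub>k\<close> for \<open>k \<noteq> j\<close>, whereas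
\<open>\<partial>\<^sub>j\<^sup>- \<L>\<^sub>j - \<L>\<^sub>j \<partial>\<^sub>j\<^sup>- = 2 \<i> \<partial>\<^sub>n\<close> for \<open>j < n\<close>
(\<open>wirtinger_bar_L_op\<close>). Moreover \<open>\<partial>\<^sub>n\<close> commutes with all of these operators.
As with the canonical commutation relations, for \<open>j < n\<close> it follows that if \<open>\<partial>\<^sub>j\<^sup>- g = 0\<close> then
\<open>\<partial>\<^sub>j\<^sup>- \<L>\<^sub>j\<^sup>m\<^sup>+\<^sup>1 g = 2 \<i> (m + 1) \<L>\<^sub>j\<^sup>m \<partial>\<^sub>n g\<close>. Hence
\<open>\<L>\<^sub>j\<^sup>m g = 0\<close> implies \<open>\<partial>\<^sub>n\<^sup>m g = 0\<close>
(\<open>wirtinger_funpow_eq_0_of_L_op\<close>), and the factors \<open>\<L>\<^sub>j\<^sup>m\<close> of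
\<open>\<L>\<^sup>\<alpha>\<close> are traded for powers of \<open>\<partial>\<^sub>n\<close> one after the other.

So \<open>f\<close> is a polynomial in \<open>t\<close> along every horizontal line
\<open>t \<mapsto> z + t e\<^sub>n\<close> (\<open>slice_polynomial\<close>). By Tonelli's theorem, finiteness of the Hardy norm
puts \<open>f\<close> into \<open>L\<^sup>p\<close> on almost all such lines at a given height above the boundary, and
the only polynomial in \<open>L\<^sup>p(\<real>)\<close> is \<open>0\<close>. Therefore \<open>f\<close> vanishes on almost all of
these lines, and by continuity on all of them.

The functions to which the operators apply are polynomials in the conjugate variables with
holomorphic coefficients. That this class is closed under differentiation rests on the fact that
a partial derivative of a holomorphic function of several variables is again holomorphic, which
follows from the one-variable Cauchy formula by differentiation under the integral.
\<close>

section \<open>Wirtinger derivatives\<close>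

definition wirtinger_bar :: "'n::finite \<Rightarrow> (complex ^ 'n \<Rightarrow> complex) \<Rightarrow> complex ^ 'n \<Rightarrow> complex"
  where "wirtinger_bar j f z =
    (vector_derivative (\<lambda>s::real. f (z + s *\<^sub>R axis j 1)) (at 0)
      + \<i> * vector_derivative (\<lambda>s::real. f (z + s *\<^sub>R axis j \<i>)) (at 0)) / 2"

text \<open>The real differential of a slice splits into a complex linear and an antilinear part, and
their coefficients are the two Wirtinger derivatives. Unlike \<open>wirtinger\<close>, which is a junk value where
the vector derivatives do not exist, this relation supports the usual calculus rules.\<close>

definition has_wirtinger ::
    "'n::finite \<Rightarrow> (complex ^ 'n \<Rightarrow> complex) \<Rightarrow> complex ^ 'n \<Rightarrow> complex \<Rightarrow> complex \<Rightarrow> bool"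
  where "has_wirtinger j f z a b \<longleftrightarrow>
    ((\<lambda>\<zeta>. f (z + axis j \<zeta>)) has_derivative (\<lambda>h. a * h + b * cnj h)) (at 0)"

lemma axis_zero [simp]: "axis j (0::complex) = 0"
  by (simp add: axis_def vec_eq_iff)

lemma axis_add: "axis j (x + y :: complex) = axis j x + axis j y"
  by (simp add: axis_def vec_eq_iff)

lemma scaleR_axis: "s *\<^sub>R axis j (c::complex) = axis j (s *\<^sub>R c)"
  by (simp add: axis_def vec_eq_iff)

lemma norm_axis_complex [simp]: "norm (axis j (c::complex)) = cmod c"
  by (simp add: norm_eq_sqrt_inner inner_axis_axis)

lemma bounded_linear_axis: "bounded_linear (axis j :: complex \<Rightarrow> complex ^ 'n::finite)"
  by (rule bounded_linear_intro[where K = 1])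
    (simp_all add: axis_add scaleR_axis)

lemmas continuous_on_axis [continuous_intros] =
  bounded_linear.continuous_on[OF bounded_linear_axis]

lemma has_wirtingerD:
  assumes "has_wirtinger j f z a b"
  shows "wirtinger j f z = a" "wirtinger_bar j f z = b"
proof -
  have d: "vector_derivative (\<lambda>s::real. f (z + s *\<^sub>R axis j c)) (at 0) = a * c + b * cnj c" for c
  proof -
    have "((\<lambda>\<zeta>. f (z + axis j \<zeta>)) has_derivative (\<lambda>h. a * h + b * cnj h)) (at ((0::real) *\<^sub>R c))"
      using assms by (simp add: has_wirtinger_def)
    moreover have "((\<lambda>s::real. s *\<^sub>R c) has_derivative (\<lambda>s. s *\<^sub>R c)) (at 0)"
      by (intro bounded_linear_imp_has_derivative bounded_linear_scaleR_left)
    ultimately have "((\<lambda>s::real. f (z + axis j (s *\<^sub>R c))) has_derivative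
        (\<lambda>s. a * (s *\<^sub>R c) + b * cnj (s *\<^sub>R c))) (at 0)"
      by (rule has_derivative_compose[rotated])
    then have "((\<lambda>s::real. f (z + s *\<^sub>R axis j c)) has_vector_derivative (a * c + b * cnj c)) (at 0)"
      by (simp add: has_vector_derivative_def scaleR_axis scaleR_add_right)
    then show ?thesis
      by (rule vector_derivative_at)
  qed
  show "wirtinger j f z = a" "wirtinger_bar j f z = b"
    unfolding wirtinger_def wirtinger_bar_def d by (simp_all add: field_simps)
qed

lemma has_wirtinger_cong:
  assumes "open S" "z \<in> S" "\<And>w. w \<in> S \<Longrightarrow> f w = g w" "has_wirtinger j f z a b"
  shows "has_wirtinger j g z a b"
proof -
  have "open ((\<lambda>\<zeta>. z + axis j \<zeta>) -` S)"
    by (intro open_vimage assms continuous_intros)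
  moreover have "0 \<in> (\<lambda>\<zeta>. z + axis j \<zeta>) -` S"
    using assms by simp
  ultimately show ?thesis
    using assms(3,4) unfolding has_wirtinger_def
    by (elim has_derivative_transform_within_open) auto
qed

lemma has_wirtinger_add:
  assumes "has_wirtinger j f z a b" "has_wirtinger j g z c d"
  shows "has_wirtinger j (\<lambda>z. f z + g z) z (a + c) (b + d)"
  using has_derivative_add[OF assms[unfolded has_wirtinger_def]]
  by (simp add: has_wirtinger_def algebra_simps)

lemma has_wirtinger_cmult:
  assumes "has_wirtinger j f z a b"
  shows "has_wirtinger j (\<lambda>z. c * f z) z (c * a) (c * b)"
  using has_derivative_mult_right[OF assms[unfolded has_wirtinger_def], of c]
  by (simp add: has_wirtinger_def algebra_simps)

text \<open>Conjugate variables are constants for \<open>\<partial>\<^sub>j\<close>; the extra term in the second coefficient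
is the origin of the commutator of \<open>\<partial>\<^sub>j\<^sup>-\<close> and \<open>\<L>\<^sub>j\<close>.\<close>

lemma has_wirtinger_cnj_mult:
  assumes "has_wirtinger j f z a b"
  shows "has_wirtinger j (\<lambda>z. cnj (z $ k) * f z) z
    (cnj (z $ k) * a) (cnj (z $ k) * b + (if j = k then f z else 0))"
proof -
  have "((\<lambda>\<zeta>. cnj ((z + axis j \<zeta>) $ k)) has_derivative (\<lambda>h. if j = k then cnj h else 0)) (at 0)"
  proof (cases "j = k")
    case True
    have "((\<lambda>\<zeta>. cnj (z $ k + \<zeta>)) has_derivative cnj) (at 0)"
      by (auto intro!: derivative_eq_intros)
    then show ?thesis
      using True by (simp add: axis_def cong: if_cong)
  qed (simp add: axis_def)
  from has_derivative_mult[OF this assms[unfolded has_wirtinger_def]]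
  show ?thesis
    unfolding has_wirtinger_def
    by (rule has_derivative_eq_rhs) (auto simp: algebra_simps)
qed

text \<open>For continuous functions, holomorphy in each variable is equivalent to holomorphy, and it is
the form in which closure under \<open>\<partial>\<^sub>j\<close> can be proved one slice at a time.\<close>

definition separately_holomorphic_on :: "(complex ^ 'n::finite \<Rightarrow> complex) \<Rightarrow> (complex ^ 'n) set \<Rightarrow> bool"
  where "separately_holomorphic_on f S \<longleftrightarrow> continuous_on S f \<and>
    (\<forall>z\<in>S. \<forall>j. (\<lambda>\<zeta>. f (z + axis j \<zeta>)) field_differentiable at 0)"

lemma holomorphic_vec_on_imp_separately:
  assumes "holomorphic_vec_on f S"
  shows "separately_holomorphic_on f S"
  unfolding separately_holomorphic_on_def
proof (intro conjI ballI allI)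
  show "continuous_on S f"
  proof (rule continuous_at_imp_continuous_on, rule ballI)
    fix z assume "z \<in> S"
    then obtain D where "(f has_derivative D) (at z)"
      using assms unfolding holomorphic_vec_on_def by blast
    then show "isCont f z"
      by (rule has_derivative_continuous)
  qed
next
  fix z j
  assume "z \<in> S"
  then obtain D where D: "(f has_derivative D) (at z)" and lin: "Vector_Spaces.linear (*s) (*) D"
    using assms unfolding holomorphic_vec_on_def by blast
  have "((\<lambda>\<zeta>. z + axis j \<zeta>) has_derivative axis j) (at 0)"
    using has_derivative_add[OF has_derivative_const
      bounded_linear_imp_has_derivative[OF bounded_linear_axis]] by simp
  moreover have "(f has_derivative D) (at (z + axis j 0))"
    using D by simp
  ultimately have "((\<lambda>\<zeta>. f (z + axis j \<zeta>)) has_derivative (\<lambda>h. D (axis j h))) (at 0)"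
    by (rule has_derivative_compose)
  moreover have "D (axis j h) = D (axis j 1) * h" for h :: complex
  proof -
    have "D (h *s axis j 1) = h * D (axis j 1)"
      using lin by (rule vector_space_pair.linear_scale[rotated])
        (simp add: vector_space_pair_def vec.vector_space_axioms vector_space_over_itself.vector_space_axioms)
    moreover have "h *s axis j 1 = (axis j h :: complex ^ 'a)"
      by (simp add: axis_def vec_eq_iff)
    ultimately show ?thesis
      by simp
  qed
  then have "(\<lambda>h. D (axis j h)) = (*) (D (axis j 1))"
    by (rule ext)
  ultimately have "((\<lambda>\<zeta>. f (z + axis j \<zeta>)) has_field_derivative D (axis j 1)) (at 0)"
    by (simp only: has_field_derivative_def)
  then show "(\<lambda>\<zeta>. f (z + axis j \<zeta>)) field_differentiable at 0"
    unfolding field_differentiable_def by blast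
qed

lemma separately_holomorphic_wirtinger:
  assumes "separately_holomorphic_on f S" "z \<in> S"
  shows "has_wirtinger j f z (wirtinger j f z) 0"
proof -
  obtain d where "((\<lambda>\<zeta>. f (z + axis j \<zeta>)) has_field_derivative d) (at 0)"
    using assms unfolding separately_holomorphic_on_def field_differentiable_def by blast
  then have "has_wirtinger j f z d 0"
    by (simp add: has_wirtinger_def has_field_derivative_def)
  with has_wirtingerD(1)[OF this] show ?thesis
    by simp
qed

lemma slice_has_field_derivative:
  assumes "separately_holomorphic_on f S" "z + axis j x \<in> S"
  shows "((\<lambda>\<zeta>. f (z + axis j \<zeta>)) has_field_derivative wirtinger j f (z + axis j x)) (at x)"
proof -
  have "((\<lambda>\<zeta>. f (z + axis j (x + \<zeta>))) has_field_derivative wirtinger j f (z + axis j x)) (at 0)"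
    using separately_holomorphic_wirtinger[OF assms, of j]
    by (simp add: has_wirtinger_def has_field_derivative_def axis_add add.assoc)
  then show ?thesis
    using DERIV_shift[of "\<lambda>\<zeta>. f (z + axis j \<zeta>)" _ 0 x] by (simp add: add.commute)
qed

text \<open>Cauchy's formula for the first derivative at the centre of a circle. The circle is written out
as an integral over the unit interval because continuity and differentiability in a parameter are
then instances of theorems on integrals over boxes.\<close>

lemma wirtinger_cauchy:
  fixes r :: real
  assumes f: "separately_holomorphic_on f S" and r: "r > 0"
    and disc: "\<And>\<zeta>. cmod \<zeta> \<le> r \<Longrightarrow> z + axis j \<zeta> \<in> S"
  shows "wirtinger j f z = integral (cbox 0 1)
    (\<lambda>t::real. f (z + axis j (r * exp (2 * of_real pi * \<i> * t))) / (r * exp (2 * of_real pi * \<i> * t)))"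
proof -
  let ?g = "\<lambda>\<zeta>. f (z + axis j \<zeta>)"
  let ?e = "\<lambda>t::real. exp (2 * of_real pi * \<i> * t)"
  have d: "(?g has_field_derivative wirtinger j f (z + axis j x)) (at x)" if "cmod x \<le> r" for x
    by (rule slice_has_field_derivative[OF f disc[OF that]])
  have "continuous_on (cball 0 r) ?g"
    using d by (intro continuous_at_imp_continuous_on ballI) (auto intro: DERIV_isCont)
  moreover have "?g holomorphic_on ball 0 r"
    unfolding holomorphic_on_open[OF open_ball]
  proof (intro ballI exI)
    fix x assume "x \<in> ball (0::complex) r"
    then show "(?g has_field_derivative wirtinger j f (z + axis j x)) (at x)"
      by (intro d) simp
  qed
  ultimately have "((\<lambda>u. ?g u / (u - 0) ^ Suc 1) has_contour_integral
      (2 * pi * \<i>) / fact 1 * (deriv ^^ 1) ?g 0) (circlepath 0 r)"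
    by (rule Cauchy_has_contour_integral_higher_derivative_circlepath) (use r in simp)
  moreover have "deriv ?g 0 = wirtinger j f z"
    using DERIV_imp_deriv[OF d[of 0]] r by simp
  ultimately have "((\<lambda>t. ?g (circlepath 0 r t) / (circlepath 0 r t)\<^sup>2 *
      vector_derivative (circlepath 0 r) (at t)) has_integral 2 * pi * \<i> * wirtinger j f z) {0..1}"
    by (simp add: has_contour_integral power2_eq_square)
  then have "((\<lambda>t. inverse (2 * pi * \<i>) * (?g (circlepath 0 r t) / (circlepath 0 r t)\<^sup>2 *
      vector_derivative (circlepath 0 r) (at t))) has_integral
      inverse (2 * pi * \<i>) * (2 * pi * \<i> * wirtinger j f z)) {0..1}"
    by (rule has_integral_mult_right)
  moreover have "inverse (2 * pi * \<i>) * (?g (circlepath 0 r t) / (circlepath 0 r t)\<^sup>2 *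
      vector_derivative (circlepath 0 r) (at t)) = ?g (r * ?e t) / (r * ?e t)" for t
  proof -
    have *: "inverse c * (y / w\<^sup>2 * (c * w)) = y / w" if "c \<noteq> 0" "w \<noteq> 0" for c w y :: complex
      using that by (simp add: field_simps power2_eq_square)
    have "inverse (2 * pi * \<i>) * (?g (r * ?e t) / (r * ?e t)\<^sup>2 * (2 * pi * \<i> * (r * ?e t)))
        = ?g (r * ?e t) / (r * ?e t)"
      by (rule *) (use r in simp_all)
    moreover have "circlepath 0 r t = r * ?e t"
      by (simp add: circlepath)
    moreover have "vector_derivative (circlepath 0 r) (at t) = (2 * pi * \<i>) * (r * ?e t)"
      unfolding vector_derivative_circlepath by (simp only: mult.assoc)
    ultimately show ?thesis
      by (simp only:)
  qed
  moreover have "inverse (2 * pi * \<i>) * (2 * pi * \<i> * wirtinger j f z) = wirtinger j f z"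
  proof -
    have "inverse c * (c * w) = w" if "c \<noteq> 0" for c w :: complex
      using that by (simp add: field_simps)
    then show ?thesis
      by this simp
  qed
  ultimately have "((\<lambda>t. ?g (r * ?e t) / (r * ?e t)) has_integral wirtinger j f z) (cbox 0 1)"
    by (simp only: cbox_interval)
  then show ?thesis
    by (simp add: integral_unique)
qed

lemma continuous_on_circle_integrand:
  fixes r :: real
  assumes f: "continuous_on S f" and r: "r > 0"
    and U: "\<And>x t. x \<in> U \<Longrightarrow> g x + axis j (r * exp (2 * of_real pi * \<i> * (t::real))) \<in> S"
    and g: "continuous_on U g"
  shows "continuous_on (U \<times> cbox 0 1) (\<lambda>(x, t::real).
    f (g x + axis j (r * exp (2 * of_real pi * \<i> * t))) / (r * exp (2 * of_real pi * \<i> * t)))"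
proof -
  have "continuous_on (U \<times> cbox 0 1) (\<lambda>p. g (fst p))"
    by (rule continuous_on_compose2[OF g]) (auto intro!: continuous_intros)
  then have "continuous_on (U \<times> cbox 0 1)
      (\<lambda>p. g (fst p) + axis j (r * exp (2 * of_real pi * \<i> * (snd p :: real))))"
    by (intro continuous_intros)
  then have "continuous_on (U \<times> cbox 0 1)
      (\<lambda>p. f (g (fst p) + axis j (r * exp (2 * of_real pi * \<i> * (snd p :: real)))))"
    by (rule continuous_on_compose2[OF f]) (use U in auto)
  moreover have "continuous_on (U \<times> cbox 0 1) (\<lambda>p. r * exp (2 * of_real pi * \<i> * (snd p :: real)))"
    by (intro continuous_intros)
  ultimately show ?thesis
    unfolding case_prod_beta by (rule continuous_on_divide) (use r in simp)
qed

lemma norm_circle_point [simp]: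
  "(r::real) > 0 \<Longrightarrow> cmod (r * exp (2 * of_real pi * \<i> * (t::real))) = r"
  by (simp add: norm_mult)

text \<open>Near a given point the circles in Cauchy's formula may all be given the same radius, so the
derivative is an integral of a jointly continuous integrand.\<close>

lemma continuous_on_wirtinger:
  assumes S: "open S" and f: "separately_holomorphic_on f S"
  shows "continuous_on S (wirtinger j f)"
proof (rule continuous_at_imp_continuous_on, rule ballI)
  fix z assume "z \<in> S"
  then obtain e where e: "e > 0" "ball z e \<subseteq> S"
    using S openE by blast
  define r where "r = e / 2"
  have r: "r > 0"
    using e by (simp add: r_def)
  have inS: "w + axis j \<zeta> \<in> S" if "w \<in> ball z r" "cmod \<zeta> \<le> r" for w \<zeta>
  proof -
    have "dist z (w + axis j \<zeta>) \<le> dist z w + norm (axis j \<zeta>)"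
      using dist_triangle[of z "w + axis j \<zeta>" w] by (simp add: dist_norm)
    also have "\<dots> < e"
      using that by (simp add: r_def)
    finally show ?thesis
      using e by auto
  qed
  have "continuous_on (ball z r) (\<lambda>w. integral (cbox 0 1)
      (\<lambda>t::real. f (w + axis j (r * exp (2 * of_real pi * \<i> * t))) / (r * exp (2 * of_real pi * \<i> * t))))"
    by (intro integral_continuous_on_param continuous_on_circle_integrand[of S] inS r)
      (use f r in \<open>auto simp: separately_holomorphic_on_def\<close>)
  then have "continuous_on (ball z r) (wirtinger j f)"
    by (rule continuous_on_eq) (use inS in \<open>simp add: wirtinger_cauchy[OF f r]\<close>)
  then show "isCont (wirtinger j f) z"
    using r by (simp add: continuous_on_eq_continuous_at)
qed

text \<open>Differentiation under the integral sign in Cauchy's formula. Its integrand differentiates to the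
integrand of the same formula for \<open>\<partial>\<^sub>k f\<close>, which yields both the holomorphy of
\<open>\<partial>\<^sub>j f\<close> and the symmetry of second derivatives.\<close>

lemma wirtinger_slice_derivative:
  assumes S: "open S" and f: "separately_holomorphic_on f S" and z: "z \<in> S"
  shows "\<exists>r>0. (\<forall>\<zeta>. cmod \<zeta> \<le> r \<longrightarrow> z + axis j \<zeta> \<in> S) \<and>
    ((\<lambda>x. wirtinger j f (z + axis k x)) has_field_derivative
      integral (cbox 0 1) (\<lambda>t::real. wirtinger k f (z + axis j (r * exp (2 * of_real pi * \<i> * t)))
        / (r * exp (2 * of_real pi * \<i> * t)))) (at 0)"
proof -
  obtain e where e: "e > 0" "ball z e \<subseteq> S"
    using S z openE by blast
  define r where "r = e / 2"
  have r: "r > 0"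
    using e by (simp add: r_def)
  let ?c = "\<lambda>t::real. r * exp (2 * of_real pi * \<i> * t)"
  have inS: "z + axis k x + axis j \<zeta> \<in> S" if "x \<in> ball 0 r" "cmod \<zeta> \<le> r" for x \<zeta>
  proof -
    have "dist z (z + axis k x + axis j \<zeta>) = norm (axis k x + axis j \<zeta>)"
      by (subst dist_commute) (simp add: dist_norm algebra_simps)
    also have "\<dots> \<le> cmod x + cmod \<zeta>"
      using norm_triangle_ineq[of "axis k x" "axis j \<zeta>"] by simp
    also have "\<dots> < e"
      using that by (simp add: r_def)
    finally show ?thesis
      using e(2) mem_ball by blast
  qed
  define F where "F x t = f (z + axis k x + axis j (?c t)) / ?c t" for x t
  define G where "G x t = wirtinger k f (z + axis k x + axis j (?c t)) / ?c t" for x t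
  have "((\<lambda>x. integral (cbox 0 1) (F x)) has_field_derivative integral (cbox 0 1) (G 0)) (at 0 within ball 0 r)"
  proof (rule leibniz_rule_field_derivative)
    fix x t assume "x \<in> ball (0::complex) r"
    then have "z + axis k x + axis j (?c t) \<in> S"
      by (rule inS) (simp only: norm_circle_point[OF r] order_refl)
    moreover have swap: "z + axis k y + axis j (?c t) = (z + axis j (?c t)) + axis k y" for y
      by (rule add.assoc[of z, THEN trans]) (simp only: add.commute add.left_commute)
    ultimately have "z + axis j (?c t) + axis k x \<in> S"
      by (simp only:)
    from slice_has_field_derivative[OF f this]
    have "((\<lambda>x. f (z + axis k x + axis j (?c t))) has_field_derivative
        wirtinger k f (z + axis k x + axis j (?c t))) (at x)"
      unfolding swap .
    then show "((\<lambda>x. F x t) has_field_derivative G x t) (at x within ball 0 r)"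
      unfolding F_def G_def by (rule DERIV_cdivide[OF has_field_derivative_at_within])
  next
    fix x assume x: "x \<in> ball (0::complex) r"
    have "continuous_on ({x} \<times> cbox 0 1) (\<lambda>(x, t). F x t)"
      unfolding F_def
      by (rule continuous_on_circle_integrand[of S])
        (use f r inS x in \<open>auto intro!: continuous_intros simp: separately_holomorphic_on_def\<close>)
    then have "continuous_on (cbox 0 1) (\<lambda>t. (\<lambda>(x, t). F x t) (x, t))"
      by (rule continuous_on_compose2) (auto intro!: continuous_intros)
    then show "F x integrable_on cbox 0 1"
      by (intro integrable_continuous) simp
  next
    show "continuous_on (ball 0 r \<times> cbox 0 1) (\<lambda>(x, t). G x t)"
      unfolding G_def
      by (rule continuous_on_circle_integrand[of S])
        (use r inS continuous_on_wirtinger[OF S f] in \<open>auto intro!: continuous_intros\<close>)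
  qed (use r in auto)
  moreover have "integral (cbox 0 1) (F x) = wirtinger j f (z + axis k x)" if "x \<in> ball 0 r" for x
    unfolding F_def[abs_def] by (rule wirtinger_cauchy[OF f r inS[OF that], symmetric])
  moreover have "((\<lambda>x. integral (cbox 0 1) (F x)) has_field_derivative integral (cbox 0 1) (G 0)) (at 0)"
    if "((\<lambda>x. integral (cbox 0 1) (F x)) has_field_derivative integral (cbox 0 1) (G 0)) (at 0 within ball 0 r)"
    using that r by (simp only: at_within_open[of 0 "ball 0 r"] open_ball centre_in_ball)
  ultimately have "((\<lambda>x. wirtinger j f (z + axis k x)) has_field_derivative integral (cbox 0 1) (G 0)) (at 0)"
    using r by (blast intro: has_field_derivative_transform_within_open[where S = "ball 0 r"] open_ball centre_in_ball[THEN iffD2])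
  moreover have "G 0 = (\<lambda>t. wirtinger k f (z + axis j (?c t)) / ?c t)"
    by (simp add: G_def[abs_def])
  moreover have "\<forall>\<zeta>. cmod \<zeta> \<le> r \<longrightarrow> z + axis j \<zeta> \<in> S"
    using inS[of 0] r by simp
  ultimately show ?thesis
    using r by (intro exI[of _ r] conjI) (simp_all only:)
qed

lemma separately_holomorphic_on_wirtinger:
  assumes "open S" "separately_holomorphic_on f S"
  shows "separately_holomorphic_on (wirtinger j f) S"
  unfolding separately_holomorphic_on_def field_differentiable_def
proof (intro conjI ballI allI)
  show "continuous_on S (wirtinger j f)"
    by (rule continuous_on_wirtinger[OF assms])
next
  fix z k assume "z \<in> S"
  from wirtinger_slice_derivative[OF assms this, of j k]
  show "\<exists>f'. ((\<lambda>\<zeta>. wirtinger j f (z + axis k \<zeta>)) has_field_derivative f') (at 0)"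
    by blast
qed

lemma wirtinger_commute_holomorphic:
  assumes S: "open S" and f: "separately_holomorphic_on f S" and z: "z \<in> S"
  shows "wirtinger j (wirtinger k f) z = wirtinger k (wirtinger j f) z"
proof -
  obtain r where r: "r > 0" "\<And>\<zeta>. cmod \<zeta> \<le> r \<Longrightarrow> z + axis j \<zeta> \<in> S"
    and d: "((\<lambda>x. wirtinger j f (z + axis k x)) has_field_derivative
      integral (cbox 0 1) (\<lambda>t::real. wirtinger k f (z + axis j (r * exp (2 * of_real pi * \<i> * t)))
        / (r * exp (2 * of_real pi * \<i> * t)))) (at 0)"
    using wirtinger_slice_derivative[OF assms] by blast
  have "wirtinger k (wirtinger j f) z = integral (cbox 0 1)
      (\<lambda>t::real. wirtinger k f (z + axis j (r * exp (2 * of_real pi * \<i> * t)))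
        / (r * exp (2 * of_real pi * \<i> * t)))"
    by (rule has_wirtingerD(1)[where b = 0])
      (use d in \<open>simp add: has_wirtinger_def has_field_derivative_def\<close>)
  also have "\<dots> = wirtinger j (wirtinger k f) z"
    by (rule wirtinger_cauchy[OF separately_holomorphic_on_wirtinger[OF S f] r, symmetric])
  finally show ?thesis
    by simp
qed

section \<open>Polynomials in the conjugate variables\<close>

text \<open>The polynomials in the conjugate variables with holomorphic coefficients: the operators
\<open>\<L>\<^sub>j\<close> lead out of the holomorphic functions, but not out of this class. The rule
\<open>cong\<close> is there because only values on \<open>S\<close> matter, while the operators act on total functions.\<close>

inductive cnj_polynomial :: "(complex ^ 'n::finite) set \<Rightarrow> (complex ^ 'n \<Rightarrow> complex) \<Rightarrow> bool"
  for S where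
  holomorphic: "separately_holomorphic_on f S \<Longrightarrow> cnj_polynomial S f"
| add: "cnj_polynomial S f \<Longrightarrow> cnj_polynomial S g \<Longrightarrow> cnj_polynomial S (\<lambda>z. f z + g z)"
| cnj_mult: "cnj_polynomial S f \<Longrightarrow> cnj_polynomial S (\<lambda>z. cnj (z $ k) * f z)"
| cong: "cnj_polynomial S f \<Longrightarrow> (\<And>z. z \<in> S \<Longrightarrow> g z = f z) \<Longrightarrow> cnj_polynomial S g"

lemma wirtinger_const: "wirtinger j (\<lambda>_. c) z = 0" "wirtinger_bar j (\<lambda>_. c) z = 0"
  by (simp_all add: wirtinger_def wirtinger_bar_def)

lemma wirtinger_cong:
  assumes "open S" "z \<in> S" "\<And>w. w \<in> S \<Longrightarrow> g w = f w" "has_wirtinger j f z a b"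
  shows "wirtinger j g z = wirtinger j f z" "wirtinger_bar j g z = wirtinger_bar j f z"
  using has_wirtinger_cong[OF assms(1,2) assms(3)[symmetric] assms(4)] assms(4)
  by (simp_all add: has_wirtingerD)

lemma cnj_polynomial_has_wirtinger:
  assumes "open S" "cnj_polynomial S f" "z \<in> S"
  shows "has_wirtinger j f z (wirtinger j f z) (wirtinger_bar j f z)"
proof -
  have "\<exists>a b. has_wirtinger j f z a b"
    using assms(2,3)
  proof (induction rule: cnj_polynomial.induct)
    case (holomorphic f)
    then show ?case
      using separately_holomorphic_wirtinger by blast
  next
    case (add f g)
    then show ?case
      using has_wirtinger_add by blast
  next
    case (cnj_mult f k)
    then show ?case
      using has_wirtinger_cnj_mult by blast
  next
    case (cong f g)
    then obtain a b where "has_wirtinger j f z a b"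
      by blast
    then have "has_wirtinger j g z a b"
      using has_wirtinger_cong[OF assms(1) cong.prems, of f g] cong.hyps by simp
    then show ?case
      by blast
  qed
  then obtain a b where "has_wirtinger j f z a b"
    by blast
  with has_wirtingerD[OF this] show ?thesis
    by simp
qed

context
  fixes S :: "(complex ^ 'n::finite) set"
  assumes S: "open S"
begin

lemma wirtinger_eq_on:
  assumes "cnj_polynomial S f" "\<And>w. w \<in> S \<Longrightarrow> g w = f w" "z \<in> S"
  shows "wirtinger j g z = wirtinger j f z" "wirtinger_bar j g z = wirtinger_bar j f z"
  using wirtinger_cong[OF S assms(3,2) cnj_polynomial_has_wirtinger[OF S assms(1,3)]] by auto

lemma wirtinger_add:
  assumes "cnj_polynomial S f" "cnj_polynomial S g" "z \<in> S"
  shows "wirtinger j (\<lambda>z. f z + g z) z = wirtinger j f z + wirtinger j g z"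
    "wirtinger_bar j (\<lambda>z. f z + g z) z = wirtinger_bar j f z + wirtinger_bar j g z"
  by (rule has_wirtingerD[OF has_wirtinger_add]; rule cnj_polynomial_has_wirtinger[OF S]; fact)+

lemma wirtinger_cmult:
  assumes "cnj_polynomial S f" "z \<in> S"
  shows "wirtinger j (\<lambda>z. c * f z) z = c * wirtinger j f z"
    "wirtinger_bar j (\<lambda>z. c * f z) z = c * wirtinger_bar j f z"
  by (rule has_wirtingerD[OF has_wirtinger_cmult]; rule cnj_polynomial_has_wirtinger[OF S]; fact)+

lemma wirtinger_cnj_mult:
  assumes "cnj_polynomial S f" "z \<in> S"
  shows "wirtinger j (\<lambda>z. cnj (z $ k) * f z) z = cnj (z $ k) * wirtinger j f z"
    "wirtinger_bar j (\<lambda>z. cnj (z $ k) * f z) z =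
      cnj (z $ k) * wirtinger_bar j f z + (if j = k then f z else 0)"
  by (rule has_wirtingerD[OF has_wirtinger_cnj_mult]; rule cnj_polynomial_has_wirtinger[OF S]; fact)+

lemma separately_holomorphic_on_const: "separately_holomorphic_on (\<lambda>_. c) S"
  by (simp add: separately_holomorphic_on_def)

lemma cnj_polynomial_cmult: "cnj_polynomial S f \<Longrightarrow> cnj_polynomial S (\<lambda>z. c * f z)"
proof (induction rule: cnj_polynomial.induct)
  case (holomorphic f)
  then have "separately_holomorphic_on (\<lambda>z. c * f z) S"
    unfolding separately_holomorphic_on_def
    by (auto intro!: continuous_intros field_differentiable_mult)
  then show ?case
    by (rule cnj_polynomial.holomorphic)
next
  case (add f g)
  then show ?case
    using cnj_polynomial.add by (fastforce simp: distrib_left)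
next
  case (cnj_mult f k)
  then show ?case
    using cnj_polynomial.cnj_mult[of S "\<lambda>z. c * f z" k] by (simp add: mult.left_commute)
next
  case (cong f g)
  show ?case
    by (rule cnj_polynomial.cong[OF cong.IH]) (simp add: cong.hyps)
qed

lemma cnj_polynomial_wirtinger: "cnj_polynomial S f \<Longrightarrow> cnj_polynomial S (wirtinger j f)"
proof (induction rule: cnj_polynomial.induct)
  case (holomorphic f)
  then show ?case
    by (intro cnj_polynomial.holomorphic separately_holomorphic_on_wirtinger S)
next
  case (add f g)
  show ?case
    by (rule cnj_polynomial.cong[OF cnj_polynomial.add[OF add.IH]]) (rule wirtinger_add[OF add.hyps])
next
  case (cnj_mult f k)
  show ?case
    by (rule cnj_polynomial.cong[OF cnj_polynomial.cnj_mult[OF cnj_mult.IH, of k]])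
      (rule wirtinger_cnj_mult[OF cnj_mult.hyps])
next
  case (cong f g)
  show ?case
    by (rule cnj_polynomial.cong[OF cong.IH]) (rule wirtinger_eq_on[OF cong.hyps])
qed

lemma wirtinger_bar_holomorphic:
  assumes "separately_holomorphic_on f S" "z \<in> S"
  shows "wirtinger_bar j f z = 0"
  using has_wirtingerD(2)[OF separately_holomorphic_wirtinger[OF assms]] .

lemma cnj_polynomial_wirtinger_bar: "cnj_polynomial S f \<Longrightarrow> cnj_polynomial S (wirtinger_bar j f)"
proof (induction rule: cnj_polynomial.induct)
  case (holomorphic f)
  show ?case
    by (rule cnj_polynomial.cong[OF cnj_polynomial.holomorphic[OF separately_holomorphic_on_const]])
      (rule wirtinger_bar_holomorphic[OF holomorphic])
next
  case (add f g)
  show ?case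
    by (rule cnj_polynomial.cong[OF cnj_polynomial.add[OF add.IH]]) (rule wirtinger_add[OF add.hyps])
next
  case (cnj_mult f k)
  have "cnj_polynomial S (\<lambda>z. if j = k then f z else 0)"
    using cnj_mult(1) by (cases "j = k")
      (auto intro: cnj_polynomial.holomorphic separately_holomorphic_on_const)
  from cnj_polynomial.add[OF cnj_polynomial.cnj_mult[OF cnj_mult.IH, of k] this]
  show ?case
    by (rule cnj_polynomial.cong) (rule wirtinger_cnj_mult[OF cnj_mult.hyps])
next
  case (cong f g)
  show ?case
    by (rule cnj_polynomial.cong[OF cong.IH]) (rule wirtinger_eq_on[OF cong.hyps])
qed

text \<open>Multiplication by conjugate variables commutes with \<open>\<partial>\<^sub>j\<close> and \<open>\<partial>\<^sub>k\<close>, which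
reduces the claim to holomorphic coefficients.\<close>

lemma wirtinger_commute:
  assumes "cnj_polynomial S f" "z \<in> S"
  shows "wirtinger j (wirtinger k f) z = wirtinger k (wirtinger j f) z"
  using assms
proof (induction arbitrary: z rule: cnj_polynomial.induct)
  case (holomorphic f)
  then show ?case
    by (rule wirtinger_commute_holomorphic[OF S])
next
  case (add f g)
  have "wirtinger j (wirtinger k (\<lambda>z. f z + g z)) z = wirtinger j (\<lambda>z. wirtinger k f z + wirtinger k g z) z"
    for j k
    by (rule wirtinger_eq_on[OF cnj_polynomial.add[OF add.hyps[THEN cnj_polynomial_wirtinger]] _ add.prems])
      (rule wirtinger_add[OF add.hyps])
  also have "wirtinger j (\<lambda>z. wirtinger k f z + wirtinger k g z) z
      = wirtinger j (wirtinger k f) z + wirtinger j (wirtinger k g) z" for j k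
    by (rule wirtinger_add[OF add.hyps[THEN cnj_polynomial_wirtinger] add.prems])
  finally show ?case
    by (simp only: add.IH[OF add.prems])
next
  case (cnj_mult f m)
  have "wirtinger j (wirtinger k (\<lambda>z. cnj (z $ m) * f z)) z = wirtinger j (\<lambda>z. cnj (z $ m) * wirtinger k f z) z"
    for j k
    by (rule wirtinger_eq_on[OF cnj_polynomial.cnj_mult[OF cnj_polynomial_wirtinger[OF cnj_mult.hyps]] _ cnj_mult.prems])
      (rule wirtinger_cnj_mult[OF cnj_mult.hyps])
  also have "wirtinger j (\<lambda>z. cnj (z $ m) * wirtinger k f z) z = cnj (z $ m) * wirtinger j (wirtinger k f) z"
    for j k
    by (rule wirtinger_cnj_mult[OF cnj_polynomial_wirtinger[OF cnj_mult.hyps] cnj_mult.prems])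
  finally show ?case
    by (simp only: cnj_mult.IH[OF cnj_mult.prems])
next
  case (cong f g)
  have "wirtinger j (wirtinger k g) z = wirtinger j (wirtinger k f) z" for j k
    by (rule wirtinger_eq_on[OF cnj_polynomial_wirtinger[OF cong.hyps(1)] _ cong.prems])
      (rule wirtinger_eq_on[OF cong.hyps])
  then show ?case
    by (simp only: cong.IH[OF cong.prems])
qed

text \<open>For a holomorphic function both sides vanish, and the term that \<open>\<partial>\<^sub>j\<^sup>-\<close> produces from a
conjugate variable is the same on both sides.\<close>

lemma wirtinger_bar_commute:
  assumes "cnj_polynomial S f" "z \<in> S"
  shows "wirtinger_bar j (wirtinger k f) z = wirtinger k (wirtinger_bar j f) z"
  using assms
proof (induction arbitrary: z rule: cnj_polynomial.induct)
  case (holomorphic f)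
  have "wirtinger_bar j (wirtinger k f) z = 0"
    using holomorphic by (intro wirtinger_bar_holomorphic separately_holomorphic_on_wirtinger S)
  moreover have "wirtinger k (wirtinger_bar j f) z = wirtinger k (\<lambda>_. 0) z"
    using holomorphic
    by (intro wirtinger_eq_on cnj_polynomial.holomorphic separately_holomorphic_on_const
        wirtinger_bar_holomorphic)
  ultimately show ?case
    by (simp add: wirtinger_const)
next
  case (add f g)
  have "wirtinger_bar j (wirtinger k (\<lambda>z. f z + g z)) z
      = wirtinger_bar j (\<lambda>z. wirtinger k f z + wirtinger k g z) z"
    by (rule wirtinger_eq_on[OF cnj_polynomial.add[OF add.hyps[THEN cnj_polynomial_wirtinger]] _ add.prems])
      (rule wirtinger_add[OF add.hyps])
  also have "\<dots> = wirtinger_bar j (wirtinger k f) z + wirtinger_bar j (wirtinger k g) z"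
    by (rule wirtinger_add[OF add.hyps[THEN cnj_polynomial_wirtinger] add.prems])
  also have "\<dots> = wirtinger k (wirtinger_bar j f) z + wirtinger k (wirtinger_bar j g) z"
    by (simp only: add.IH[OF add.prems])
  also have "\<dots> = wirtinger k (\<lambda>z. wirtinger_bar j f z + wirtinger_bar j g z) z"
    by (rule wirtinger_add[OF add.hyps[THEN cnj_polynomial_wirtinger_bar] add.prems, symmetric])
  also have "\<dots> = wirtinger k (wirtinger_bar j (\<lambda>z. f z + g z)) z"
    by (rule wirtinger_eq_on[OF cnj_polynomial.add[OF add.hyps[THEN cnj_polynomial_wirtinger_bar]]
          _ add.prems, symmetric]) (rule wirtinger_add[OF add.hyps])
  finally show ?case .
next
  case (cnj_mult f m)
  let ?d = "\<lambda>f z. if j = m then f z else (0::complex)"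
  note f = cnj_mult.hyps and z = cnj_mult.prems
  have d: "cnj_polynomial S (?d f)"
    using f by (cases "j = m")
      (auto intro: cnj_polynomial.holomorphic separately_holomorphic_on_const)
  have "wirtinger_bar j (wirtinger k (\<lambda>z. cnj (z $ m) * f z)) z
      = wirtinger_bar j (\<lambda>z. cnj (z $ m) * wirtinger k f z) z"
    by (rule wirtinger_eq_on[OF cnj_polynomial.cnj_mult[OF cnj_polynomial_wirtinger[OF f]] _ z])
      (rule wirtinger_cnj_mult[OF f])
  also have "\<dots> = cnj (z $ m) * wirtinger_bar j (wirtinger k f) z + ?d (wirtinger k f) z"
    by (rule wirtinger_cnj_mult[OF cnj_polynomial_wirtinger[OF f] z])
  also have "\<dots> = cnj (z $ m) * wirtinger k (wirtinger_bar j f) z + wirtinger k (?d f) z"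
    by (simp add: cnj_mult.IH[OF z] wirtinger_const)
  also have "\<dots> = wirtinger k (\<lambda>z. cnj (z $ m) * wirtinger_bar j f z) z + wirtinger k (?d f) z"
    by (simp only: wirtinger_cnj_mult[OF cnj_polynomial_wirtinger_bar[OF f] z])
  also have "\<dots> = wirtinger k (\<lambda>z. cnj (z $ m) * wirtinger_bar j f z + ?d f z) z"
    by (rule wirtinger_add[OF cnj_polynomial.cnj_mult[OF cnj_polynomial_wirtinger_bar[OF f]] d z, symmetric])
  also have "\<dots> = wirtinger k (wirtinger_bar j (\<lambda>z. cnj (z $ m) * f z)) z"
    by (rule wirtinger_eq_on[OF cnj_polynomial.add[OF
          cnj_polynomial.cnj_mult[OF cnj_polynomial_wirtinger_bar[OF f]] d] _ z, symmetric])
      (rule wirtinger_cnj_mult[OF f])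
  finally show ?case .
next
  case (cong f g)
  have "wirtinger_bar j (wirtinger k g) z = wirtinger_bar j (wirtinger k f) z"
    by (rule wirtinger_eq_on[OF cnj_polynomial_wirtinger[OF cong.hyps(1)] _ cong.prems])
      (rule wirtinger_eq_on[OF cong.hyps])
  also have "\<dots> = wirtinger k (wirtinger_bar j f) z"
    by (rule cong.IH[OF cong.prems])
  also have "\<dots> = wirtinger k (wirtinger_bar j g) z"
    by (rule wirtinger_eq_on[OF cnj_polynomial_wirtinger_bar[OF cong.hyps(1)] _ cong.prems, symmetric])
      (rule wirtinger_eq_on[OF cong.hyps])
  finally show ?case .
qed

end

section \<open>Reduction to a power of the last derivative\<close>

text \<open>A single formula for all indices, in which the case distinction is confined to a constant factor.
This makes the rules for sums, constant multiples and conjugate variables applicable at once.\<close>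

lemma L_op_eq:
  "L_op j f = (\<lambda>z. wirtinger j f z +
    (if j = last_ix then 0 else 2 * \<i>) * (cnj (z $ j) * wirtinger last_ix f z))"
  by (auto simp: L_op_def fun_eq_iff)

text \<open>What an operator must satisfy in order that \<open>\<partial>\<^sub>n\<close> can be moved past it on \<open>S\<close>. The middle
condition, that the result on \<open>S\<close> depends only on the argument on \<open>S\<close>, is what makes the
property stable under composition, and hence under the products that form \<open>\<L>\<^sup>\<alpha>\<close>.\<close>

definition commuting_operator ::
    "(complex ^ 'n::{finite,linorder}) set \<Rightarrow>
      ((complex ^ 'n::{finite,linorder} \<Rightarrow> complex) \<Rightarrow> complex ^ 'n::{finite,linorder} \<Rightarrow> complex) \<Rightarrow> bool"
  where "commuting_operator S T \<longleftrightarrow> (\<forall>f. cnj_polynomial S f \<longrightarrow>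
    cnj_polynomial S (T f) \<and>
    (\<forall>g. (\<forall>z\<in>S. g z = f z) \<longrightarrow> (\<forall>z\<in>S. T g z = T f z)) \<and>
    (\<forall>z\<in>S. wirtinger last_ix (T f) z = T (wirtinger last_ix f) z))"

lemma commuting_operatorD:
  assumes "commuting_operator S T" "cnj_polynomial S f"
  shows "cnj_polynomial S (T f)"
    "(\<And>z. z \<in> S \<Longrightarrow> g z = f z) \<Longrightarrow> z \<in> S \<Longrightarrow> T g z = T f z"
    "z \<in> S \<Longrightarrow> wirtinger last_ix (T f) z = T (wirtinger last_ix f) z"
  using assms unfolding commuting_operator_def by blast+

context
  fixes S :: "(complex ^ 'n::{finite,linorder}) set"
  assumes S: "open S"
begin

lemma commuting_operator_id: "commuting_operator S (\<lambda>f. f)"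
  by (simp add: commuting_operator_def)

lemma commuting_operator_comp:
  assumes "commuting_operator S T" "commuting_operator S U"
  shows "commuting_operator S (\<lambda>f. T (U f))"
  unfolding commuting_operator_def
proof (intro allI impI conjI ballI)
  fix f assume f: "cnj_polynomial S f"
  note U = commuting_operatorD[OF assms(2) f] and T = commuting_operatorD[OF assms(1) commuting_operatorD(1)[OF assms(2) f]]
  show "cnj_polynomial S (T (U f))"
    by (rule T)
  show "T (U g) z = T (U f) z" if "\<forall>z\<in>S. g z = f z" "z \<in> S" for g z
    using that by (intro T U) auto
  show "wirtinger last_ix (T (U f)) z = T (U (wirtinger last_ix f)) z" if "z \<in> S" for z
  proof -
    have "wirtinger last_ix (T (U f)) z = T (wirtinger last_ix (U f)) z"
      by (rule T(3)[OF that])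
    also have "\<dots> = T (U (wirtinger last_ix f)) z"
      by (rule commuting_operatorD(2)[OF assms(1) commuting_operatorD(1)[OF assms(2)
            cnj_polynomial_wirtinger[OF S f]] U(3) that])
    finally show ?thesis .
  qed
qed

lemma commuting_operator_funpow:
  assumes "commuting_operator S T"
  shows "commuting_operator S (T ^^ m)"
proof (induction m)
  case 0
  then show ?case
    using commuting_operator_id by (simp add: id_def)
next
  case (Suc m)
  then show ?case
    using commuting_operator_comp[OF assms Suc] by (simp add: o_def)
qed

lemma commuting_operator_wirtinger: "commuting_operator S (wirtinger last_ix)"
  unfolding commuting_operator_def
  using cnj_polynomial_wirtinger[OF S] wirtinger_eq_on(1)[OF S] by blast

lemma cnj_polynomial_L_op:
  assumes "cnj_polynomial S f"
  shows "cnj_polynomial S (L_op j f)"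
  unfolding L_op_eq
  by (intro cnj_polynomial.add cnj_polynomial_cmult[OF S] cnj_polynomial.cnj_mult
      cnj_polynomial_wirtinger[OF S] assms)

lemma L_op_eq_on:
  assumes "cnj_polynomial S f" "\<And>w. w \<in> S \<Longrightarrow> g w = f w" "z \<in> S"
  shows "L_op j g z = L_op j f z"
  unfolding L_op_def by (simp only: wirtinger_eq_on(1)[OF S assms])

lemma L_op_cmult:
  assumes "cnj_polynomial S f" "z \<in> S"
  shows "L_op j (\<lambda>z. c * f z) z = c * L_op j f z"
  unfolding L_op_def by (simp add: wirtinger_cmult[OF S assms] algebra_simps)

lemma wirtinger_L_op:
  assumes f: "cnj_polynomial S f" and z: "z \<in> S"
  shows "wirtinger last_ix (L_op j f) z = L_op j (wirtinger last_ix f) z"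
proof -
  note W = cnj_polynomial_wirtinger[OF S f]
  show ?thesis
    unfolding L_op_eq
    by (simp only: wirtinger_add[OF S W cnj_polynomial_cmult[OF S cnj_polynomial.cnj_mult[OF W]] z]
        wirtinger_cmult[OF S cnj_polynomial.cnj_mult[OF W] z] wirtinger_cnj_mult[OF S W z]
        wirtinger_commute[OF S f z, of last_ix j])
qed

text \<open>The commutation relation: \<open>\<partial>\<^sub>j\<^sup>-\<close> meets a conjugate variable in \<open>\<L>\<^sub>k\<close> only as the coefficient
of \<open>\<partial>\<^sub>n\<close>, and only for \<open>k = j\<close>.\<close>

lemma wirtinger_bar_L_op:
  assumes f: "cnj_polynomial S f" and z: "z \<in> S"
  shows "wirtinger_bar j (L_op k f) z = L_op k (wirtinger_bar j f) z +
    (if j = k \<and> k \<noteq> last_ix then 2 * \<i> * wirtinger last_ix f z else 0)"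
proof -
  note W = cnj_polynomial_wirtinger[OF S f]
  show ?thesis
    unfolding L_op_eq
    by (simp only: wirtinger_add[OF S W cnj_polynomial_cmult[OF S cnj_polynomial.cnj_mult[OF W]] z]
        wirtinger_cmult[OF S cnj_polynomial.cnj_mult[OF W] z] wirtinger_cnj_mult[OF S W z]
        wirtinger_bar_commute[OF S f z]) (simp add: algebra_simps)
qed

lemma commuting_operator_L_op: "commuting_operator S (L_op j)"
  unfolding commuting_operator_def
  using cnj_polynomial_L_op L_op_eq_on wirtinger_L_op by blast

definition cnj_free ::
    "'n::{finite,linorder} \<Rightarrow> (complex ^ 'n::{finite,linorder} \<Rightarrow> complex) \<Rightarrow> bool"
  where "cnj_free j f \<longleftrightarrow> cnj_polynomial S f \<and> (\<forall>z\<in>S. wirtinger_bar j f z = 0)"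

lemma cnj_freeD: "cnj_free j f \<Longrightarrow> cnj_polynomial S f" "cnj_free j f \<Longrightarrow> z \<in> S \<Longrightarrow> wirtinger_bar j f z = 0"
  by (auto simp: cnj_free_def)

lemma operator_zero:
  assumes "\<And>z. z \<in> S \<Longrightarrow> f z = 0" "z \<in> S"
  shows "wirtinger j f z = 0" "wirtinger_bar j f z = 0" "L_op j f z = 0"
proof -
  have 0: "cnj_polynomial S (\<lambda>_. 0)"
    by (intro cnj_polynomial.holomorphic separately_holomorphic_on_const[OF S])
  show 1: "wirtinger j f z = 0" "wirtinger_bar j f z = 0" for j
    using wirtinger_eq_on[OF S 0 assms] by (simp_all add: wirtinger_const)
  show "L_op j f z = 0"
    by (simp add: L_op_def 1)
qed

lemma cnj_free_L_op:
  assumes f: "cnj_free j f" and "k \<noteq> j"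
  shows "cnj_free j (L_op k f)"
  unfolding cnj_free_def
proof (intro conjI ballI)
  show "cnj_polynomial S (L_op k f)"
    by (rule cnj_polynomial_L_op[OF cnj_freeD(1)[OF f]])
  show "wirtinger_bar j (L_op k f) z = 0" if "z \<in> S" for z
    using \<open>k \<noteq> j\<close> wirtinger_bar_L_op[OF cnj_freeD(1)[OF f] that]
      operator_zero(3)[OF cnj_freeD(2)[OF f] that] by simp
qed

lemma cnj_free_wirtinger:
  assumes f: "cnj_free j f"
  shows "cnj_free j (wirtinger k f)"
  unfolding cnj_free_def
proof (intro conjI ballI)
  show "cnj_polynomial S (wirtinger k f)"
    by (rule cnj_polynomial_wirtinger[OF S cnj_freeD(1)[OF f]])
  show "wirtinger_bar j (wirtinger k f) z = 0" if "z \<in> S" for z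
    using wirtinger_bar_commute[OF S cnj_freeD(1)[OF f] that]
      operator_zero(1)[OF cnj_freeD(2)[OF f] that] by simp
qed

lemma cnj_free_funpow:
  assumes "\<And>f. cnj_free j f \<Longrightarrow> cnj_free j (T f)" "cnj_free j f"
  shows "cnj_free j ((T ^^ m) f)"
  using assms(2) by (induction m) (simp_all add: assms(1))

text \<open>Moving \<open>\<partial>\<^sub>j\<^sup>-\<close> to the right past \<open>m + 1\<close> factors \<open>\<L>\<^sub>j\<close> leaves one commutator per factor,
and these are all equal because \<open>\<partial>\<^sub>n\<close> commutes with \<open>\<L>\<^sub>j\<close>.\<close>

lemma wirtinger_bar_L_op_funpow:
  assumes j: "j \<noteq> last_ix" and f: "cnj_free j f" and "z \<in> S"
  shows "wirtinger_bar j ((L_op j ^^ Suc m) f) z =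
    2 * \<i> * of_nat (Suc m) * (L_op j ^^ m) (wirtinger last_ix f) z"
  using \<open>z \<in> S\<close>
proof (induction m arbitrary: z)
  case 0
  then show ?case
    using j wirtinger_bar_L_op[OF cnj_freeD(1)[OF f] 0, of j j]
      operator_zero(3)[OF cnj_freeD(2)[OF f] 0] by simp
next
  case (Suc m)
  note T = commuting_operator_funpow[OF commuting_operator_L_op]
  let ?P = "wirtinger last_ix"
  let ?g = "(L_op j ^^ Suc m) f"
  have f': "cnj_polynomial S f"
    by (rule cnj_freeD(1)[OF f])
  have g: "cnj_polynomial S ?g"
    by (rule commuting_operatorD(1)[OF T f'])
  have Pf: "cnj_polynomial S ((L_op j ^^ m) (?P f))"
    by (rule commuting_operatorD(1)[OF T cnj_polynomial_wirtinger[OF S f']])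
  have "wirtinger_bar j ((L_op j ^^ Suc (Suc m)) f) z = wirtinger_bar j (L_op j ?g) z"
    by simp
  also have "\<dots> = L_op j (wirtinger_bar j ?g) z + 2 * \<i> * ?P ?g z"
    using j wirtinger_bar_L_op[OF g Suc.prems, of j j] by simp
  also have "L_op j (wirtinger_bar j ?g) z =
      L_op j (\<lambda>z. 2 * \<i> * of_nat (Suc m) * (L_op j ^^ m) (?P f) z) z"
    by (rule L_op_eq_on[OF cnj_polynomial_cmult[OF S Pf] Suc.IH Suc.prems])
  also have "\<dots> = 2 * \<i> * of_nat (Suc m) * (L_op j ^^ Suc m) (?P f) z"
    using L_op_cmult[OF Pf Suc.prems] by simp
  also have "?P ?g z = (L_op j ^^ Suc m) (?P f) z"
    by (rule commuting_operatorD(3)[OF T f' Suc.prems])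
  finally show ?case
    by (simp add: algebra_simps)
qed

text \<open>Applying \<open>\<partial>\<^sub>j\<^sup>-\<close> to \<open>\<L>\<^sub>j\<^sup>m\<^sup>+\<^sup>1 f = 0\<close> gives \<open>\<L>\<^sub>j\<^sup>m (\<partial>\<^sub>n f) = 0\<close>, and \<open>\<partial>\<^sub>n f\<close> is again annihilated by
\<open>\<partial>\<^sub>j\<^sup>-\<close>; so each factor \<open>\<L>\<^sub>j\<close> can be replaced by \<open>\<partial>\<^sub>n\<close>.\<close>

lemma wirtinger_funpow_eq_0_of_L_op:
  assumes "cnj_free j f" and "\<And>z. z \<in> S \<Longrightarrow> (L_op j ^^ m) f z = 0" and "z \<in> S"
  shows "(wirtinger last_ix ^^ m) f z = 0"
proof (cases "j = last_ix")
  case True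
  then have "L_op j = wirtinger last_ix"
    by (intro ext) (simp add: L_op_def)
  then show ?thesis
    using assms by simp
next
  case False
  show ?thesis
    using assms
  proof (induction m arbitrary: f z)
    case 0
    then show ?case
      by simp
  next
    case (Suc m)
    have "(L_op j ^^ m) (wirtinger last_ix f) z = 0" if "z \<in> S" for z
    proof -
      have "2 * \<i> * of_nat (Suc m) * (L_op j ^^ m) (wirtinger last_ix f) z = 0"
        using wirtinger_bar_L_op_funpow[OF False Suc.prems(1) that, of m]
          operator_zero(2)[OF Suc.prems(2) that, where j = j] by simp
      then show ?thesis
        by (simp del: of_nat_Suc)
    qed
    from Suc.IH[OF cnj_free_wirtinger[OF Suc.prems(1)] this Suc.prems(3)]
    show ?case
      by (simp only: funpow_Suc_right o_apply)
  qed
qed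

text \<open>The outermost factor \<open>\<L>\<^sub>j\<^sup>m\<close> acts on a function in which the remaining operators
have not introduced the conjugate of \<open>z\<^sub>j\<close>, as the indices are distinct. It can therefore be
replaced by \<open>\<partial>\<^sub>n\<^sup>m\<close>, which moves past the remaining operators onto \<open>f\<close>.\<close>

lemma wirtinger_funpow_eq_0_of_product:
  fixes \<alpha> :: "nat ^ 'n::{finite,linorder}"
  assumes "distinct js" and f: "\<And>j. cnj_free j f"
    and "\<And>z. z \<in> S \<Longrightarrow> foldr (\<lambda>j. L_op j ^^ (\<alpha> $ j)) js f z = 0"
  shows "\<exists>m. \<forall>z\<in>S. (wirtinger last_ix ^^ m) f z = 0"
  using assms
proof (induction js arbitrary: f)
  case Nil
  then show ?case
    by (intro exI[of _ 0]) simp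
next
  case (Cons j js)
  let ?P = "wirtinger last_ix" and ?M = "foldr (\<lambda>j. L_op j ^^ (\<alpha> $ j)) js"
  have M: "commuting_operator S (foldr (\<lambda>j. L_op j ^^ (\<alpha> $ j)) ks)" for ks
  proof (induction ks)
    case Nil
    then show ?case
      using commuting_operator_id by (simp add: id_def)
  next
    case (Cons k ks)
    then show ?case
      using commuting_operator_comp[OF commuting_operator_funpow[OF commuting_operator_L_op] Cons]
      by (simp add: o_def)
  qed
  have "cnj_free j (foldr (\<lambda>j. L_op j ^^ (\<alpha> $ j)) ks f)" if "j \<notin> set ks" for ks
    using that by (induction ks) (auto intro!: cnj_free_funpow cnj_free_L_op Cons.prems)
  then have "cnj_free j (?M f)"
    using Cons.prems(1) by simp
  moreover have "(L_op j ^^ (\<alpha> $ j)) (?M f) z = 0" if "z \<in> S" for z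
    using Cons.prems(3)[OF that] by simp
  ultimately have zero: "(?P ^^ (\<alpha> $ j)) (?M f) z = 0" if "z \<in> S" for z
    using that by (rule wirtinger_funpow_eq_0_of_L_op)
  have swap: "(?P ^^ m) (?M g) z = ?M ((?P ^^ m) g) z" if "cnj_polynomial S g" "z \<in> S" for m g z
    using that
  proof (induction m arbitrary: g z)
    case 0
    then show ?case
      by simp
  next
    case (Suc m)
    note g = Suc.prems(1)
    have "(?P ^^ Suc m) (?M g) z = (?P ^^ m) (?P (?M g)) z"
      by (simp only: funpow_Suc_right o_apply)
    also have "\<dots> = (?P ^^ m) (?M (?P g)) z"
      by (rule commuting_operatorD(2)[OF commuting_operator_funpow[OF commuting_operator_wirtinger]
            commuting_operatorD(1)[OF M cnj_polynomial_wirtinger[OF S g]]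
            commuting_operatorD(3)[OF M g] Suc.prems(2)])
    also have "\<dots> = ?M ((?P ^^ m) (?P g)) z"
      by (rule Suc.IH[OF cnj_polynomial_wirtinger[OF S g] Suc.prems(2)])
    finally show ?case
      by (simp only: funpow_Suc_right o_apply)
  qed
  have "\<exists>m. \<forall>z\<in>S. (?P ^^ m) ((?P ^^ (\<alpha> $ j)) f) z = 0"
  proof (rule Cons.IH)
    show "distinct js"
      using Cons.prems(1) by simp
    show "cnj_free k ((?P ^^ (\<alpha> $ j)) f)" for k
      by (intro cnj_free_funpow cnj_free_wirtinger Cons.prems)
    show "?M ((?P ^^ (\<alpha> $ j)) f) z = 0" if "z \<in> S" for z
      using zero[OF that] swap[OF cnj_freeD(1)[OF Cons.prems(2)] that] by simp
  qed
  then obtain m where "\<forall>z\<in>S. (?P ^^ m) ((?P ^^ (\<alpha> $ j)) f) z = 0"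
    by blast
  then show ?case
    by (intro exI[of _ "m + \<alpha> $ j"]) (simp add: funpow_add)
qed

lemma wirtinger_funpow_eq_0_of_L_pow:
  assumes f: "separately_holomorphic_on f S" and "\<And>z. z \<in> S \<Longrightarrow> L_pow \<alpha> f z = 0"
  shows "\<exists>m. \<forall>z\<in>S. (wirtinger last_ix ^^ m) f z = 0"
proof (rule wirtinger_funpow_eq_0_of_product)
  show "distinct (sorted_list_of_set (UNIV :: 'n set))"
    by simp
  show "cnj_free j f" for j
    using wirtinger_bar_holomorphic[OF S f] cnj_polynomial.holomorphic[OF f]
    by (simp add: cnj_free_def)
  show "foldr (\<lambda>j. L_op j ^^ (\<alpha> $ j)) (sorted_list_of_set UNIV) f z = 0" if "z \<in> S" for z
    using assms(2)[OF that] by (simp add: L_pow_def)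
qed

end

section \<open>Integrability on horizontal lines\<close>

lemma open_siegel: "open siegel"
  unfolding siegel_def by (intro open_Collect_less continuous_intros)

lemma siegel_add_axis_iff:
  "z + axis last_ix \<zeta> \<in> siegel \<longleftrightarrow>
    Im \<zeta> > (\<Sum>j\<in>- {last_ix}. (cmod (z $ j))\<^sup>2) - Im (z $ last_ix)"
proof -
  have "(\<Sum>j\<in>- {last_ix}. (cmod ((z + axis last_ix \<zeta>) $ j))\<^sup>2) = (\<Sum>j\<in>- {last_ix}. (cmod (z $ j))\<^sup>2)"
    by (intro sum.cong) (auto simp: axis_def)
  then show ?thesis
    by (auto simp: siegel_def axis_def)
qed

text \<open>The slice of the half-space in direction \<open>e\<^sub>n\<close> is a half-plane, hence convex, and Taylor's formula
on it has remainder \<open>0\<close>.\<close>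

lemma slice_polynomial:
  assumes f: "separately_holomorphic_on f siegel"
    and zero: "\<And>z. z \<in> siegel \<Longrightarrow> (wirtinger last_ix ^^ m) f z = 0"
    and z: "z \<in> siegel"
  shows "\<exists>c. \<forall>t::real. f (z + axis last_ix (of_real t)) = (\<Sum>i\<le>m. c i * (of_real t) ^ i)"
proof -
  define T where "T = {\<zeta>. z + axis last_ix \<zeta> \<in> siegel}"
  define F where "F i \<zeta> = (wirtinger last_ix ^^ i) f (z + axis last_ix \<zeta>)" for i \<zeta>
  have hol: "separately_holomorphic_on ((wirtinger last_ix ^^ i) f) siegel" for i
    by (induction i) (simp_all add: f separately_holomorphic_on_wirtinger[OF open_siegel])
  have "T = {\<zeta>. (\<Sum>j\<in>- {last_ix}. (cmod (z $ j))\<^sup>2) - Im (z $ last_ix) < Im \<zeta>}"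
    by (simp add: T_def siegel_add_axis_iff)
  then have "convex T"
    using convex_halfspace_Im_gt by simp
  have z': "0 > (\<Sum>j\<in>- {last_ix}. (cmod (z $ j))\<^sup>2) - Im (z $ last_ix)"
    using z by (simp add: siegel_def)
  have deriv: "(F i has_field_derivative F (Suc i) \<zeta>) (at \<zeta> within T)" if "\<zeta> \<in> T" for i \<zeta>
  proof -
    from that have "z + axis last_ix \<zeta> \<in> siegel"
      by (simp add: T_def)
    from slice_has_field_derivative[OF hol this, of i]
    show ?thesis
      unfolding F_def[abs_def] by (simp add: has_field_derivative_at_within)
  qed
  (* The remainder after degree m involves the derivative of order m + 1. *)
  have small: "cmod (F (Suc m) \<zeta>) \<le> 0" if "\<zeta> \<in> T" for \<zeta>
    using operator_zero(1)[OF open_siegel zero] that by (simp add: F_def T_def)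
  have taylor: "cmod (F 0 \<zeta> - (\<Sum>i\<le>m. F i 0 * (\<zeta> - 0) ^ i / fact i)) \<le> 0 * cmod (\<zeta> - 0) ^ Suc m / fact m"
    if "\<zeta> \<in> T" for \<zeta>
  proof (rule complex_Taylor[where f = F and S = T])
    show "0 \<in> T"
      using z by (simp add: T_def)
  qed (use that \<open>convex T\<close> deriv small in auto)
  show ?thesis
  proof (intro exI allI)
    fix t :: real
    have "of_real t \<in> T"
      using z' by (simp add: T_def siegel_add_axis_iff)
    from taylor[OF this] show "f (z + axis last_ix (of_real t)) = (\<Sum>i\<le>m. (F i 0 / fact i) * (of_real t) ^ i)"
      by (simp add: F_def)
  qed
qed

text \<open>A nonconstant polynomial tends to infinity, so a polynomial other than \<open>0\<close> is bounded away
from \<open>0\<close> on a half-line.\<close>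

lemma polynomial_eq_0_of_integrable_powr:
  fixes c :: "nat \<Rightarrow> complex"
  assumes p: "p > 0"
    and g: "\<And>t::real. g t = (\<Sum>i\<le>m. c i * (of_real t) ^ i)"
    and fin: "(\<integral>\<^sup>+ t. ennreal (cmod (g t) powr p) \<partial>lborel) \<noteq> \<infinity>"
  shows "g t = 0"
proof (rule ccontr)
  assume "g t \<noteq> 0"
  have "\<exists>e>0. \<exists>b. \<forall>t\<ge>b. e \<le> cmod (g t) powr p"
  proof (cases "\<exists>k. k \<noteq> 0 \<and> k \<le> m \<and> c k \<noteq> 0")
    case True
    from polyfun_extremal[OF this, of 1] obtain b
      where b: "\<And>z. b \<le> cmod z \<Longrightarrow> 1 \<le> cmod (\<Sum>i\<le>m. c i * z ^ i)"
      unfolding eventually_at_infinity by blast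
    have "1 \<le> cmod (g t) powr p" if "max b 0 \<le> t" for t
      using b[of "of_real t"] that p by (simp add: g ge_one_powr_ge_zero)
    then show ?thesis
      by (intro exI[of _ 1] conjI exI[of _ "max b 0"]) auto
  next
    case False
    have "g s = c 0" for s
    proof -
      have "g s = (\<Sum>i\<in>{0}. c i * (of_real s) ^ i)"
        unfolding g by (rule sum.mono_neutral_right) (use False in auto)
      then show ?thesis
        by simp
    qed
    then show ?thesis
      using \<open>g t \<noteq> 0\<close> by (intro exI[of _ "cmod (c 0) powr p"] conjI) auto
  qed
  then obtain e b where e: "e > 0" and b: "\<And>t. t \<ge> b \<Longrightarrow> e \<le> cmod (g t) powr p"
    by blast
  let ?I = "\<integral>\<^sup>+ t. ennreal (cmod (g t) powr p) \<partial>lborel"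
  have "ennreal (e * real n) \<le> ?I" for n
  proof -
    have "ennreal (e * real n) = (\<integral>\<^sup>+ t. ennreal e * indicator {b..b + real n} t \<partial>lborel)"
      using e by (subst nn_integral_cmult_indicator) (simp_all add: ennreal_mult)
    also have "\<dots> \<le> ?I"
      by (intro nn_integral_mono) (auto split: split_indicator simp: b)
    finally show ?thesis .
  qed
  moreover obtain r where r: "?I = ennreal r" "r \<ge> 0"
    using fin by (cases ?I) auto
  ultimately have le: "e * real n \<le> r" for n
    using ennreal_le_iff by metis
  obtain n where "r / e < real n"
    using reals_Archimedean2 by blast
  then show False
    using le[of n] e by (simp add: divide_less_eq mult.commute)
qed

lemma emeasure_lborel_open_neq_0:
  fixes x :: "'a::euclidean_space"
  assumes "open A" "x \<in> A"
  shows "emeasure lborel A \<noteq> 0"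
proof -
  obtain r where r: "r > 0" "ball x r \<subseteq> A"
    using assms openE by blast
  have "emeasure lborel (ball x r) \<noteq> 0"
    using content_ball_pos[OF r(1), of x] by (auto simp: measure_def)
  moreover have "emeasure lborel (ball x r) \<le> emeasure lborel A"
    using r assms by (intro emeasure_mono) auto
  ultimately show ?thesis
    by auto
qed

lemma hardy_space_integral_finite:
  assumes "f \<in> hardy_space p" "\<epsilon> > 0"
  shows "(\<integral>\<^sup>+ u. ennreal (cmod (f (u + \<epsilon> *\<^sub>R base_pt)) powr p) \<partial>boundary_measure) \<noteq> \<infinity>"
proof
  let ?I = "\<integral>\<^sup>+ u. ennreal (cmod (f (u + \<epsilon> *\<^sub>R base_pt)) powr p) \<partial>boundary_measure"
  assume I: "?I = \<infinity>"
  have "ennreal_powr ?I (1 / p) \<le> hardy_norm p f"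
    unfolding hardy_norm_def by (rule SUP_upper) (use assms in simp)
  then have "hardy_norm p f = \<infinity>"
    by (simp add: I ennreal_powr_def top_unique)
  then show False
    using assms by (simp add: hardy_space_def)
qed

lemma boundary_param_in_boundary: "boundary_param x \<in> siegel_boundary"
  by (cases x) (auto simp: boundary_param_def siegel_boundary_def)

lemma base_pt_scaleR: "\<epsilon> *\<^sub>R base_pt = axis last_ix (\<epsilon> *\<^sub>R \<i>)"
  by (simp add: base_pt_def scaleR_axis)

lemma boundary_add_base_pt_in_siegel:
  assumes "u \<in> siegel_boundary" "\<epsilon> > 0"
  shows "u + \<epsilon> *\<^sub>R base_pt \<in> siegel"
  using assms by (simp add: base_pt_scaleR siegel_add_axis_iff siegel_boundary_def)

lemma boundary_param_split:
  "boundary_param (w, t) = boundary_param (w, 0) + axis last_ix (of_real t)"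
  by (auto simp: boundary_param_def vec_eq_iff axis_def)

text \<open>By Tonelli's theorem, finiteness of the integral over the boundary translated by \<open>\<epsilon>\<close> makes the
inner integral over the line through almost every \<open>w\<close> finite.\<close>

lemma almost_every_line_vanishes:
  fixes f :: "complex ^ 'n::{finite,linorder} \<Rightarrow> complex"
  assumes p: "1 \<le> p" and f: "f \<in> hardy_space p" and \<epsilon>: "\<epsilon> > 0"
    and zero: "\<And>z. z \<in> siegel \<Longrightarrow> (wirtinger last_ix ^^ m) f z = 0"
  shows "AE w in (\<Pi>\<^sub>M j\<in>- {last_ix :: 'n}. (lborel :: complex measure)).
    \<forall>t. f (boundary_param (w, t) + \<epsilon> *\<^sub>R base_pt) = 0"
proof -
  let ?M = "\<Pi>\<^sub>M j\<in>- {last_ix :: 'n}. (lborel :: complex measure)"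
  have hol: "separately_holomorphic_on f siegel"
    using f by (intro holomorphic_vec_on_imp_separately) (simp add: hardy_space_def)
  let ?F = "\<lambda>u. ennreal (cmod (f (u + \<epsilon> *\<^sub>R base_pt)) powr p)"
  have "continuous_on siegel_boundary (\<lambda>u. f (u + \<epsilon> *\<^sub>R base_pt))"
  proof (rule continuous_on_compose2[of siegel f])
    show "continuous_on siegel f"
      using hol by (simp add: separately_holomorphic_on_def)
    show "continuous_on siegel_boundary (\<lambda>u. u + \<epsilon> *\<^sub>R base_pt)"
      by (intro continuous_intros)
    show "(\<lambda>u. u + \<epsilon> *\<^sub>R base_pt) ` siegel_boundary \<subseteq> siegel"
      using boundary_add_base_pt_in_siegel[OF _ \<epsilon>] by blast
  qed
  from borel_measurable_continuous_on_restrict[OF this]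
  have "(\<lambda>u. f (u + \<epsilon> *\<^sub>R base_pt)) \<in> borel_measurable (restrict_space borel siegel_boundary)" .
  then have F: "?F \<in> borel_measurable (restrict_space borel siegel_boundary)"
    by measurable
  have G: "(\<lambda>x. ?F (boundary_param x)) \<in> borel_measurable (?M \<Otimes>\<^sub>M lborel)"
    by (rule measurable_compose[OF boundary_param_measurable F])
  have "(\<integral>\<^sup>+ w. \<integral>\<^sup>+ t. ?F (boundary_param (w, t)) \<partial>lborel \<partial>?M) \<noteq> \<infinity>"
    using hardy_space_integral_finite[OF f \<epsilon>]
    by (simp add: nn_integral_boundary_measure[OF F] lborel.nn_integral_fst[OF G])
  from nn_integral_PInf_AE[OF lborel.borel_measurable_nn_integral_fst[OF G] this]
  have "AE w in ?M. (\<integral>\<^sup>+ t. ?F (boundary_param (w, t)) \<partial>lborel) \<noteq> \<infinity>" .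
  then show ?thesis
  proof (rule AE_mp, intro AE_I2 impI allI)
    fix w t
    assume fin: "(\<integral>\<^sup>+ t. ?F (boundary_param (w, t)) \<partial>lborel) \<noteq> \<infinity>"
    let ?z = "boundary_param (w, 0) + \<epsilon> *\<^sub>R base_pt"
    obtain c where c: "f (?z + axis last_ix (of_real t)) = (\<Sum>i\<le>m. c i * (of_real t) ^ i)" for t :: real
      using slice_polynomial[OF hol zero boundary_add_base_pt_in_siegel[OF boundary_param_in_boundary \<epsilon>]]
      by blast
    have line: "boundary_param (w, t) + \<epsilon> *\<^sub>R base_pt = ?z + axis last_ix (of_real t)" for t
      by (subst boundary_param_split) (simp add: add_ac)
    have "f (boundary_param (w, t) + \<epsilon> *\<^sub>R base_pt) = (\<Sum>i\<le>m. c i * (of_real t) ^ i)" for t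
      by (subst line) (rule c)
    then show "f (boundary_param (w, t) + \<epsilon> *\<^sub>R base_pt) = 0"
      by (rule polynomial_eq_0_of_integrable_powr[rotated]) (use p fin in auto)
  qed
qed

theorem corollary1p2:
  fixes p :: real
    and f :: "complex ^ 'n::{finite,linorder} \<Rightarrow> complex"
    and \<alpha> :: "nat ^ 'n::{finite,linorder}"
  assumes "1 \<le> p"
    and "f \<in> hardy_space p"
    and "\<forall>z\<in>siegel. L_pow \<alpha> f z = 0"
  shows "\<forall>z\<in>siegel. f z = 0"
proof (rule ballI, rule ccontr)
  fix z assume z: "z \<in> siegel" and fz: "f z \<noteq> 0"
  let ?I = "- {last_ix :: 'n}"
  let ?M = "\<Pi>\<^sub>M j\<in>?I. (lborel :: complex measure)"
  have hol: "separately_holomorphic_on f siegel"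
    using assms by (intro holomorphic_vec_on_imp_separately) (simp add: hardy_space_def)
  obtain m where m: "\<And>z. z \<in> siegel \<Longrightarrow> (wirtinger last_ix ^^ m) f z = 0"
    using wirtinger_funpow_eq_0_of_L_pow[OF open_siegel hol] assms(3) by blast
  define \<epsilon> where "\<epsilon> = Im (z $ last_ix) - (\<Sum>j\<in>?I. (cmod (z $ j))\<^sup>2)"
  have \<epsilon>: "\<epsilon> > 0"
    using z by (simp add: \<epsilon>_def siegel_def)
  (* The height epsilon and the real part of z_n are kept while z' varies over all of the
     remaining coordinates, so that phi fixes z and has values in the half-space. *)
  define \<phi> :: "complex ^ 'n::{finite,linorder} \<Rightarrow> complex ^ 'n::{finite,linorder}"
    where "\<phi> v = boundary_param (($) v, Re (z $ last_ix)) + \<epsilon> *\<^sub>R base_pt" for v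
  have \<phi>_eq: "\<phi> v = (\<chi> j. if j = last_ix
      then Re (z $ last_ix) + \<i> * of_real (\<Sum>k\<in>?I. (cmod (v $ k))\<^sup>2) + \<i> * \<epsilon> else v $ j)" for v
    by (auto simp: \<phi>_def boundary_param_def base_pt_scaleR vec_eq_iff axis_def complex_eq_iff)
  have "continuous_on UNIV \<phi>"
    unfolding \<phi>_eq[abs_def]
  proof (rule continuous_on_vec_lambda)
    show "continuous_on UNIV (\<lambda>v :: complex ^ 'n::{finite,linorder}. if j = last_ix
        then Re (z $ last_ix) + \<i> * of_real (\<Sum>k\<in>?I. (cmod (v $ k))\<^sup>2) + \<i> * \<epsilon> else v $ j)" for j
      by (cases "j = last_ix") (auto intro!: continuous_intros)
  qed
  then have "continuous_on UNIV (\<lambda>v. f (\<phi> v))"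
    by (rule continuous_on_compose2[of siegel f, rotated])
      (use hol boundary_add_base_pt_in_siegel[OF boundary_param_in_boundary \<epsilon>]
        in \<open>auto simp: separately_holomorphic_on_def \<phi>_def\<close>)
  then have "open ((\<lambda>v. f (\<phi> v)) -` (- {0}))"
    by (intro open_vimage) auto
  then have nbhd: "\<forall>x\<in>(\<lambda>v. f (\<phi> v)) -` (- {0}). \<exists>A. (\<forall>i. open (A i) \<and> x $ i \<in> A i) \<and>
      (\<forall>y. (\<forall>i. y $ i \<in> A i) \<longrightarrow> y \<in> (\<lambda>v. f (\<phi> v)) -` (- {0}))"
    by (simp only: open_vec_def)
  have "\<phi> z = z"
    by (auto simp: \<phi>_eq vec_eq_iff complex_eq_iff \<epsilon>_def)
  then have "z \<in> (\<lambda>v. f (\<phi> v)) -` (- {0})"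
    using fz by simp
  from bspec[OF nbhd this] obtain A where "\<forall>i. open (A i) \<and> z $ i \<in> A i"
    and sub: "\<forall>v. (\<forall>i. v $ i \<in> A i) \<longrightarrow> f (\<phi> v) \<noteq> 0"
    by auto
  then have A: "open (A i)" "z $ i \<in> A i" for i
    by auto
  (* The neighbourhood is a product of open sets, so its measure is a product of positive numbers. *)
  interpret product_sigma_finite "\<lambda>_::'n. lborel :: complex measure"
    by standard
  have "emeasure ?M (Pi\<^sub>E ?I A) = (\<Prod>i\<in>?I. emeasure lborel (A i))"
    using A by (intro emeasure_PiM) auto
  moreover have "emeasure lborel (A i) \<noteq> 0" for i
    by (rule emeasure_lborel_open_neq_0[OF A])
  ultimately have pos: "emeasure ?M (Pi\<^sub>E ?I A) \<noteq> 0"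
    by simp
  have "AE w in ?M. \<forall>t. f (boundary_param (w, t) + \<epsilon> *\<^sub>R base_pt) = 0"
    by (rule almost_every_line_vanishes[OF assms(1,2) \<epsilon>]) (rule m)
  then have "AE w in ?M. w \<notin> Pi\<^sub>E ?I A"
  proof (rule AE_mp, intro AE_I2 impI notI)
    fix w
    assume 0: "\<forall>t. f (boundary_param (w, t) + \<epsilon> *\<^sub>R base_pt) = 0" and w: "w \<in> Pi\<^sub>E ?I A"
    define v :: "complex ^ 'n::{finite,linorder}" where "v = (\<chi> j. if j = last_ix then z $ last_ix else w j)"
    have "f (\<phi> v) \<noteq> 0"
      using w A(2) by (intro sub[rule_format]) (auto simp: v_def PiE_iff)
    moreover have "\<phi> v = boundary_param (w, Re (z $ last_ix)) + \<epsilon> *\<^sub>R base_pt"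
      by (auto simp: \<phi>_def boundary_param_def v_def vec_eq_iff intro!: sum.cong)
    ultimately show False
      using 0 by simp
  qed
  then have "emeasure ?M {w \<in> space ?M. w \<in> Pi\<^sub>E ?I A} = 0"
    by (rule emeasure_eq_0_AE)
  moreover have "{w \<in> space ?M. w \<in> Pi\<^sub>E ?I A} = Pi\<^sub>E ?I A"
    by (auto simp: space_PiM)
  ultimately show False
    using pos by simp
qed

end
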